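(* Let $G=(V,E)$ be a nonempty finite graph in which every vertex carries a loop, let $f$ be an optimal opinion function of $G$, and let $H$ be the graph obtained from $G$ by deleting $k$ non-loop edges, where $k=l+s+m$: $l$ of the deleted edges join two vertices with $f$-opinion $+1$, $s$ of them join two vertices with $f$-opinion $-1$, and the remaining $m$ join a vertex with opinion $+1$ and a vertex with opinion $-1$. Then $$-4l-2m\le \gamma(G)-\gamma(H)\le 2k.$$
   Context: All graphs are finite with vertex set $V$, $|V|=n$, and every vertex has a loop. For $v\in V$, the neighborhood $N_v=\{w\in V:(v,w)\in E\}$ contains $v$ itself. An opinion function is a map $f:V\to\{-1,1\}$ (opinion $+1$ is "for", $-1$ is "against"), extended to subsets by $f(W)=\sum_{w\in W}f(w)$. $V^+=\{v\in V: f(N_v)>0\}$. The opinion function $f$ is strictly majoritarian on the graph if $|V^+|>|V|/2$. The strict domination number is $\gamma(G)=\min\{f(V): f \text{ strictly majoritarian on } G\}$, and an opinion function of a graph is optimal if it is strictly majoritarian on that graph and $f(V)$ equals its strict domination number. *)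

theory Defs
  imports Complex_Main "HOL-Library.FuncSet"
begin

text \<open>
  An undirected graph with vertex set \<open>V\<close> has as edges unordered pairs of vertices:
  the edge joining \<open>u\<close> and \<open>v\<close> is the set \<open>{u, v}\<close>, so the loop at \<open>v\<close> is the singleton \<open>{v}\<close>.
\<close>

definition looped_graph :: "'a set \<Rightarrow> 'a set set \<Rightarrow> bool" where
  "looped_graph V E \<longleftrightarrow>
     finite V \<and>
     (\<forall>e\<in>E. \<exists>u\<in>V. \<exists>v\<in>V. e = {u, v}) \<and>
     (\<forall>v\<in>V. {v} \<in> E)"

definition neighborhood :: "'a set \<Rightarrow> 'a set set \<Rightarrow> 'a \<Rightarrow> 'a set" where
  "neighborhood V E v = {w \<in> V. {v, w} \<in> E}"

text \<open>
  Opinion functions are total HOL functions; their values outside \<open>V\<close> are irrelevant.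
\<close>

definition opinion_function :: "'a set \<Rightarrow> ('a \<Rightarrow> int) \<Rightarrow> bool" where
  "opinion_function V f \<longleftrightarrow> f \<in> V \<rightarrow> {-1, 1}"

definition positive_vertices :: "'a set \<Rightarrow> 'a set set \<Rightarrow> ('a \<Rightarrow> int) \<Rightarrow> 'a set" where
  "positive_vertices V E f = {v \<in> V. sum f (neighborhood V E v) > 0}"

definition strictly_majoritarian :: "'a set \<Rightarrow> 'a set set \<Rightarrow> ('a \<Rightarrow> int) \<Rightarrow> bool" where
  "strictly_majoritarian V E f \<longleftrightarrow>
     opinion_function V f \<and> real (card (positive_vertices V E f)) > real (card V) / 2"

definition strict_domination_number :: "'a set \<Rightarrow> 'a set set \<Rightarrow> int" where
  "strict_domination_number V E = Min {sum f V | f. strictly_majoritarian V E f}"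

definition optimal :: "'a set \<Rightarrow> 'a set set \<Rightarrow> ('a \<Rightarrow> int) \<Rightarrow> bool" where
  "optimal V E f \<longleftrightarrow>
     strictly_majoritarian V E f \<and> sum f V = strict_domination_number V E"

text \<open>
  The minimum above is well defined: its set of values is always finite, and it is nonempty
  for every nonempty looped graph.
\<close>

lemma finite_majoritarian_sums:
  assumes "finite V"
  shows "finite {sum f V | f. strictly_majoritarian V E f}"
proof (rule finite_subset)
  show "{sum f V | f. strictly_majoritarian V E f} \<subseteq> {- int (card V)..int (card V)}"
  proof clarify
    fix f assume "strictly_majoritarian V E f"
    then have f: "\<bar>f v\<bar> \<le> 1" if "v \<in> V" for v
      using that by (auto simp: strictly_majoritarian_def opinion_function_def Pi_iff)
    have "\<bar>sum f V\<bar> \<le> (\<Sum>v\<in>V. \<bar>f v\<bar>)" by (rule sum_abs)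
    also have "\<dots> \<le> (\<Sum>v\<in>V. 1)" using f by (intro sum_mono) auto
    finally show "sum f V \<in> {- int (card V)..int (card V)}" by auto
  qed
qed simp

lemma majoritarian_sums_nonempty:
  assumes "looped_graph V E" "V \<noteq> {}"
  shows "{sum f V | f. strictly_majoritarian V E f} \<noteq> {}"
proof -
  have fin: "finite V" using assms by (simp add: looped_graph_def)
  have "finite (neighborhood V E v)" "v \<in> neighborhood V E v" if "v \<in> V" for v
    using that assms fin by (auto simp: looped_graph_def neighborhood_def)
  then have "card (neighborhood V E v) > 0" if "v \<in> V" for v
    using that by (auto simp: card_gt_0_iff)
  then have "positive_vertices V E (\<lambda>_. 1) = V"
    by (auto simp: positive_vertices_def)
  moreover have "card V > 0" using fin assms by (simp add: card_gt_0_iff)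
  ultimately have "strictly_majoritarian V E (\<lambda>_. 1)"
    by (simp add: strictly_majoritarian_def opinion_function_def)
  then show ?thesis by blast
qed

end

theory Submission
  imports Defs
begin

text \<open>
  Upper bound: restoring a single edge to \<open>H\<close> lowers the vote only at its two ends, and
  turning one of its opponents (if any) into a supporter makes up for both losses; this costs 2
  per edge and can be iterated. Lower bound: the edges are deleted all at once. A vertex \<open>v\<close> that
  loses \<open>d v\<close> supporting neighbours is compensated by converting \<open>d v\<close> of its
  opposing neighbours, or all of them if there are fewer. Since a deleted edge counts in the sum of
  all \<open>d v\<close> twice if it joins two supporters, once if it is mixed, and otherwise not at
  all, the cost is at most \<open>2 * (2 * l + m)\<close>.
\<close>

section \<open>Optimal functions and looped graphs\<close>

lemma strict_domination_number_le:
  assumes "finite V" "strictly_majoritarian V E f"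
  shows "strict_domination_number V E \<le> sum f V"
  unfolding strict_domination_number_def
  using finite_majoritarian_sums[OF assms(1)] assms(2) by (intro Min_le) auto

lemma optimal_exists:
  assumes "looped_graph V E" "V \<noteq> {}"
  obtains f where "optimal V E f"
proof -
  have "finite V" using assms(1) by (simp add: looped_graph_def)
  from Min_in[OF finite_majoritarian_sums[OF this] majoritarian_sums_nonempty[OF assms]]
  show ?thesis using that by (force simp: optimal_def strict_domination_number_def)
qed

text \<open>Reduces both bounds to a check vertex by vertex: it is enough that the changed opinions
  keep every positive vertex positive on the new edge set.\<close>

lemma strictly_majoritarian_mono:
  assumes "finite V" "strictly_majoritarian V E f" "opinion_function V g"
    and "positive_vertices V E f \<subseteq> positive_vertices V E' g"
  shows "strictly_majoritarian V E' g"
proof -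
  have "card (positive_vertices V E f) \<le> card (positive_vertices V E' g)"
    using assms by (intro card_mono) (auto simp: positive_vertices_def)
  then show ?thesis using assms by (auto simp: strictly_majoritarian_def)
qed

lemma opinion_cases: "opinion_function V f \<Longrightarrow> v \<in> V \<Longrightarrow> f v = -1 \<or> f v = 1"
  by (auto simp: opinion_function_def Pi_iff)

lemma looped_graph_edgeE:
  assumes "looped_graph V E" "e \<in> E"
  obtains u v where "e = {u, v}" "u \<in> V" "v \<in> V"
  using assms by (auto simp: looped_graph_def)

lemma looped_graph_delete:
  assumes "looped_graph V E" "\<forall>v. {v} \<notin> D"
  shows "looped_graph V (E - D)"
  using assms by (auto simp: looped_graph_def)

lemma looped_graph_finite_edges:
  assumes "looped_graph V E"
  shows "finite E"
  using assms by (auto simp: looped_graph_def intro!: finite_subset[of E "Pow V"])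

section \<open>Converting opponents into supporters\<close>

definition convert :: "'a set \<Rightarrow> ('a \<Rightarrow> int) \<Rightarrow> 'a \<Rightarrow> int" where
  "convert X f v = (if v \<in> X then 1 else f v)"

lemma opinion_function_convert: "opinion_function V f \<Longrightarrow> opinion_function V (convert X f)"
  by (simp add: opinion_function_def convert_def Pi_iff)

text \<open>Every vertex of \<open>X\<close> rises from -1 to 1, hence the factor 2. With
  \<open>N\<close> a neighborhood this measures the gain of a vertex; with \<open>N = V\<close> it
  measures the cost of the conversion.\<close>

lemma sum_convert:
  assumes "finite N" "\<forall>v\<in>X. f v = -1"
  shows "sum (convert X f) N = sum f N + 2 * int (card (N \<inter> X))"
proof -
  have "sum (convert X f) N = (\<Sum>v\<in>N. f v + (if v \<in> X then 2 else 0))"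
    using assms by (intro sum.cong) (auto simp: convert_def)
  then show ?thesis
    using assms(1) by (simp add: sum.distrib flip: sum.inter_restrict)
qed

section \<open>Upper bound: restoring edges one at a time\<close>

lemma sum_neighborhood_insert:
  assumes "finite V" "u \<in> V" "v \<in> V" "{u, v} \<notin> E"
  shows "sum f (neighborhood V (insert {u, v} E) u) = f v + sum f (neighborhood V E u)"
proof -
  have "neighborhood V (insert {u, v} E) u = insert v (neighborhood V E u)"
    using assms by (auto simp: neighborhood_def doubleton_eq_iff)
  moreover have "v \<notin> neighborhood V E u" "finite (neighborhood V E u)"
    using assms by (auto simp: neighborhood_def)
  ultimately show ?thesis by simp
qed

lemma neighborhood_insert_other:
  assumes "w \<noteq> u" "w \<noteq> v"
  shows "neighborhood V (insert {u, v} E) w = neighborhood V E w"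
  using assms by (auto simp: neighborhood_def doubleton_eq_iff)

lemma strict_domination_number_insert_le:
  assumes G: "looped_graph V E" and "V \<noteq> {}"
    and uv: "u \<in> V" "v \<in> V" "u \<noteq> v" "{u, v} \<notin> E"
  shows "strict_domination_number V (insert {u, v} E) \<le> strict_domination_number V E + 2"
proof -
  obtain h where h: "optimal V E h" using optimal_exists[OF assms(1,2)] .
  then have maj: "strictly_majoritarian V E h" by (simp add: optimal_def)
  then have op: "opinion_function V h" by (simp add: strictly_majoritarian_def)
  have fin: "finite V" using G by (simp add: looped_graph_def)
  then have finN: "finite (neighborhood V E w)" for w by (auto simp: neighborhood_def)
  \<comment> \<open>At most one end is converted, even if both oppose: in that case \<open>v\<close>
    is converted and \<open>u\<close> stays an opponent.\<close>
  define X where "X = (if h v = -1 then {v} else if h u = -1 then {u} else {})"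
  have neg: "\<forall>w\<in>X. h w = -1" by (auto simp: X_def)
  have in_own: "w \<in> neighborhood V E w" if "w \<in> V" for w
    using G that by (auto simp: neighborhood_def looped_graph_def)
  \<comment> \<open>Through its loop a converted vertex votes in its own neighborhood, so it gains
    at least 2 there.\<close>
  have own: "1 \<le> card (neighborhood V E w \<inter> X)" if "w \<in> X" "w \<in> V" for w
    using in_own[OF that(2)] that(1) finN by (auto simp: Suc_le_eq card_gt_0_iff)
  have conv: "sum (convert X h) N \<ge> sum h N" if "finite N" for N
    using sum_convert[OF that neg] by simp
  have "sum (convert X h) (neighborhood V (insert {u, v} E) w) > 0"
    if w: "w \<in> positive_vertices V E h" for w
  proof -
    have pos: "0 < sum h (neighborhood V E w)" and "w \<in> V"
      using w by (auto simp: positive_vertices_def)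
    \<comment> \<open>Stated for an ordered pair \<open>x\<close>, \<open>y\<close> so that it
      serves both ends of the new edge; \<open>y\<close> is the neighbor that \<open>x\<close>
      acquires.\<close>
    have end_pos: "sum (convert X h) (neighborhood V (insert {u, v} E) x) > 0"
      if "x = w" "{x, y} = {u, v}" for x y
    proof -
      have xy: "x \<in> V" "y \<in> V" "{x, y} \<notin> E" using that uv by auto
      have eq: "sum (convert X h) (neighborhood V (insert {u, v} E) x) =
          convert X h y + (sum h (neighborhood V E x) + 2 * int (card (neighborhood V E x \<inter> X)))"
        unfolding sum_neighborhood_insert[OF fin xy, unfolded that(2)] that(2) sum_convert[OF finN neg] by (rule refl)
      \<comment> \<open>Either the new neighbor supports after the conversion, or it contributes -1
        to a converted end \<open>x\<close>, whose own gain of 2 outweighs this.\<close>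
      have "convert X h y = 1 \<or> x \<in> X \<and> convert X h y = -1"
        using that(2) opinion_cases[OF op xy(1)] opinion_cases[OF op xy(2)]
        by (auto simp: convert_def X_def doubleton_eq_iff)
      then show ?thesis using eq own[of x] xy pos that(1) by auto
    qed
    show ?thesis
    proof (cases "w = u \<or> w = v")
      case True
      then show ?thesis using end_pos[of w u] end_pos[of w v] by (auto simp: insert_commute)
    next
      case False
      then show ?thesis
        using neighborhood_insert_other[of w u v V E] conv[OF finN[of w]] pos by simp
    qed
  qed
  then have "positive_vertices V E h \<subseteq> positive_vertices V (insert {u, v} E) (convert X h)"
    by (auto simp: positive_vertices_def)
  then have "strict_domination_number V (insert {u, v} E) \<le> sum (convert X h) V"
    by (intro strict_domination_number_le strictly_majoritarian_mono[OF fin maj]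
        opinion_function_convert fin op)
  also have "\<dots> = sum h V + 2 * int (card (V \<inter> X))" by (rule sum_convert[OF fin neg])
  also have "card (V \<inter> X) \<le> 1" by (auto simp: X_def Int_insert_right)
  finally show ?thesis using h by (simp add: optimal_def)
qed

text \<open>Induction on \<open>D\<close>: the graphs with edges \<open>E - insert e D\<close> and
  \<open>E - D\<close> differ by the single edge \<open>e\<close>, which is not a loop, so each
  restored edge costs at most 2.\<close>

lemma strict_domination_number_le_delete:
  assumes "looped_graph V E" "V \<noteq> {}" "D \<subseteq> E" "\<forall>v. {v} \<notin> D"
  shows "strict_domination_number V E \<le> strict_domination_number V (E - D) + 2 * int (card D)"
proof -
  have "finite D" using looped_graph_finite_edges[OF assms(1)] assms(3) by (rule finite_subset[rotated])
  then show ?thesis using assms(3,4)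
  proof (induction D)
    case (insert e D)
    then obtain u v where e: "e = {u, v}" "u \<in> V" "v \<in> V"
      using looped_graph_edgeE[OF assms(1), of e] by auto
    have "u \<noteq> v" using insert.prems e by auto
    moreover have "looped_graph V (E - insert e D)"
      by (rule looped_graph_delete[OF assms(1) insert.prems(2)])
    moreover have "insert e (E - insert e D) = E - D" using insert by auto
    ultimately have "strict_domination_number V (E - D)
        \<le> strict_domination_number V (E - insert e D) + 2"
      using strict_domination_number_insert_le[of V "E - insert e D" u v] assms(2) e by simp
    moreover have "strict_domination_number V E
        \<le> strict_domination_number V (E - D) + 2 * int (card D)"
      using insert.prems by (intro insert.IH) auto
    ultimately show ?case using insert.hyps by simp
  qed simp
qed

section \<open>Lower bound: counting lost supporters\<close>

definition lost_supporters :: "'a set \<Rightarrow> 'a set set \<Rightarrow> ('a \<Rightarrow> int) \<Rightarrow> 'a \<Rightarrow> 'a set" where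
  "lost_supporters V D f v = {w \<in> V. {v, w} \<in> D \<and> f w = 1}"

text \<open>The vote drops by the sum of \<open>f\<close> over the lost neighbors. Lost opponents
  contribute -1 to that sum, so bounding them by 0 leaves the number of lost supporters.\<close>

lemma sum_neighborhood_delete:
  assumes "finite V" "opinion_function V f" "D \<subseteq> E"
  shows "sum f (neighborhood V E v)
    \<le> sum f (neighborhood V (E - D) v) + int (card (lost_supporters V D f v))"
proof -
  let ?L = "neighborhood V D v"
  have fin: "finite (neighborhood V F v)" for F using assms(1) by (auto simp: neighborhood_def)
  have split: "neighborhood V E v = neighborhood V (E - D) v \<union> ?L"
    using assms(3) by (auto simp: neighborhood_def)
  have "sum f (neighborhood V E v) = sum f (neighborhood V (E - D) v) + sum f ?L"
    unfolding split by (rule sum.union_disjoint[OF fin fin]) (auto simp: neighborhood_def)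
  moreover have "sum f ?L \<le> (\<Sum>w\<in>?L. if f w = 1 then 1 else 0)"
    using assms(2) by (intro sum_mono) (auto simp: neighborhood_def dest: opinion_cases)
  moreover have "\<dots> = int (card (lost_supporters V D f v))"
    using fin by (simp add: lost_supporters_def neighborhood_def Int_def conj_assoc
        flip: sum.inter_filter)
  ultimately show ?thesis by simp
qed

text \<open>Double counting of pairs of a vertex and a deleted edge through which it loses a
  supporter: first by vertices, then by edges.\<close>

lemma sum_card_lost_supporters_le:
  assumes "looped_graph V E" "opinion_function V f" "D \<subseteq> E"
  shows "(\<Sum>v\<in>V. card (lost_supporters V D f v))
    \<le> 2 * card {e \<in> D. \<exists>u v. e = {u, v} \<and> f u = 1 \<and> f v = 1}
      + card {e \<in> D. \<exists>u v. e = {u, v} \<and> f u = 1 \<and> f v = -1}"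
proof -
  have fin: "finite V" using assms(1) by (simp add: looped_graph_def)
  have finD: "finite D"
    using looped_graph_finite_edges[OF assms(1)] assms(3) by (rule finite_subset[rotated])
  define P where "P = {e \<in> D. \<exists>u v. e = {u, v} \<and> f u = 1 \<and> f v = 1}"
  define M where "M = {e \<in> D. \<exists>u v. e = {u, v} \<and> f u = 1 \<and> f v = -1}"
  \<comment> \<open>These are the ends of \<open>e\<close> whose opposite end supports, that is,
    those that lose a supporter with \<open>e\<close>.\<close>
  define ends where "ends = (\<lambda>e. {v \<in> V. \<exists>w\<in>V. e = {v, w} \<and> f w = 1})"
  have "(\<Sum>v\<in>V. card (lost_supporters V D f v)) = (\<Sum>v\<in>V. card {e \<in> D. v \<in> ends e})"
  proof (rule sum.cong[OF refl])
    fix v assume v: "v \<in> V"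
    have "{e \<in> D. v \<in> ends e} = (\<lambda>w. {v, w}) ` lost_supporters V D f v"
      using v by (auto simp: lost_supporters_def ends_def)
    moreover have "inj_on (\<lambda>w. {v, w}) (lost_supporters V D f v)"
      by (auto simp: inj_on_def doubleton_eq_iff)
    ultimately show "card (lost_supporters V D f v) = card {e \<in> D. v \<in> ends e}"
      by (simp add: card_image)
  qed
  also have "\<dots> = (\<Sum>v\<in>V. \<Sum>e | e \<in> D \<and> v \<in> ends e. 1)" by simp
  also have "\<dots> = (\<Sum>e\<in>D. \<Sum>v | v \<in> V \<and> v \<in> ends e. 1)"
    by (rule sum.swap_restrict[OF fin finD])
  also have "\<dots> = (\<Sum>e\<in>D. card (ends e))"
    by (intro sum.cong refl) (simp add: ends_def)
  also have "\<dots> \<le> (\<Sum>e\<in>D. 2 * (if e \<in> P then 1 else 0) + (if e \<in> M then 1 else 0))"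
  proof (rule sum_mono)
    fix e assume e: "e \<in> D"
    obtain u v where uv: "e = {u, v}" "u \<in> V" "v \<in> V"
      using looped_graph_edgeE[OF assms(1) subsetD[OF assms(3) e]] .
    have two: "card (ends e) \<le> 2"
    proof -
      have "card (ends e) \<le> card {u, v}" using uv by (intro card_mono) (auto simp: ends_def)
      also have "\<dots> \<le> 2" by (simp add: card_insert_if)
      finally show ?thesis .
    qed
    consider "f u = 1" "f v = 1" | "f u = 1" "f v = -1" | "f u = -1" "f v = 1"
      | "f u = -1" "f v = -1"
      using opinion_cases[OF assms(2) uv(2)] opinion_cases[OF assms(2) uv(3)] by auto
    then show "card (ends e) \<le> 2 * (if e \<in> P then 1 else 0) + (if e \<in> M then 1 else 0)"
    proof cases
      case 1
      then have "e \<in> P" unfolding P_def using e uv by blast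
      then show ?thesis using two by simp
    next
      case 2
      \<comment> \<open>On a mixed edge only the opponent loses a supporter.\<close>
      then have "ends e = {v}" using uv by (auto simp: ends_def doubleton_eq_iff)
      moreover have "e \<in> M" unfolding M_def using e uv 2 by blast
      ultimately show ?thesis by simp
    next
      case 3
      then have "ends e = {u}" using uv by (auto simp: ends_def doubleton_eq_iff)
      moreover have "e \<in> M" unfolding M_def using e uv 3 by blast
      ultimately show ?thesis by simp
    next
      case 4
      then have "ends e = {}" using uv by (auto simp: ends_def doubleton_eq_iff)
      then show ?thesis by simp
    qed
  qed
  also have "\<dots> = 2 * card P + card M"
  proof -
    have "D \<inter> P = P" "D \<inter> M = M" by (auto simp: P_def M_def)
    then have "(\<Sum>e\<in>D. if e \<in> P then 1 else 0) = card P"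
      "(\<Sum>e\<in>D. if e \<in> M then 1 else 0) = card M"
      using finD by (simp_all flip: sum.inter_restrict)
    then show ?thesis by (simp add: sum.distrib flip: sum_distrib_left)
  qed
  finally show ?thesis by (simp only: P_def M_def)
qed

section \<open>Lower bound: deleting all edges at once\<close>

lemma ex_subset_card_min: "\<exists>S. S \<subseteq> A \<and> card S = min n (card A)"
  by (rule obtain_subset_with_card_n[of "min n (card A)" A]) auto

text \<open>A positive vertex stays positive for one of two reasons: enough opponents around it were
  converted to repay its loss, or no opponent is left in its neighborhood.\<close>

lemma strict_domination_number_delete_le:
  assumes G: "looped_graph V E" and maj: "strictly_majoritarian V E f"
    and D: "D \<subseteq> E" "\<forall>v. {v} \<notin> D"
  shows "strict_domination_number V (E - D)
    \<le> sum f V + 2 * int (\<Sum>v\<in>V. card (lost_supporters V D f v))"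
proof -
  have fin: "finite V" using G by (simp add: looped_graph_def)
  have op: "opinion_function V f" using maj by (simp add: strictly_majoritarian_def)
  let ?N = "neighborhood V (E - D)"
  let ?d = "\<lambda>v. card (lost_supporters V D f v)"
  have finN: "finite (?N v)" for v using fin by (auto simp: neighborhood_def)
  \<comment> \<open>Only opponents still adjacent after the deletion count, since converting others
    would not help \<open>v\<close>.\<close>
  define opp where "opp v = {w \<in> ?N v. f w = -1}" for v
  have "\<forall>v. \<exists>T. T \<subseteq> opp v \<and> card T = min (?d v) (card (opp v))"
    by (intro allI ex_subset_card_min)
  from choice[OF this] obtain S
    where "\<forall>v. S v \<subseteq> opp v \<and> card (S v) = min (?d v) (card (opp v))" ..
  then have S: "S v \<subseteq> opp v" "card (S v) = min (?d v) (card (opp v))" for v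
    by simp_all
  have finS: "finite (S v)" for v
    using finite_subset[OF S(1)] finN by (simp add: opp_def)
  define X where "X = (\<Union>v\<in>V. S v)"
  have neg: "\<forall>v\<in>X. f v = -1" using S(1) by (auto simp: X_def opp_def)
  have "sum (convert X f) (?N v) > 0" if v: "v \<in> positive_vertices V E f" for v
  \<comment> \<open>If \<open>S v\<close> has full size, the gain is at least
    \<open>2 * ?d v\<close> against a loss of at most \<open>?d v\<close>. Otherwise the minimum is
    \<open>card (opp v)\<close>, so all of \<open>opp v\<close> is converted.\<close>
  proof (cases "card (S v) = ?d v")
    case True
    have "v \<in> V" using v by (auto simp: positive_vertices_def)
    then have "S v \<subseteq> ?N v \<inter> X" using S(1)[of v] by (auto simp: X_def opp_def)
    then have "?d v \<le> card (?N v \<inter> X)"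
      using card_mono[of "?N v \<inter> X" "S v"] True finN by simp
    moreover have "0 < sum f (neighborhood V E v)" using v by (simp add: positive_vertices_def)
    ultimately show ?thesis
      using sum_convert[OF finN neg, of v] sum_neighborhood_delete[OF fin op D(1), of v] by simp
  next
    case False
    have "v \<in> V" using v by (auto simp: positive_vertices_def)
    have "finite (opp v)" using finN by (simp add: opp_def)
    moreover have "card (S v) = card (opp v)" using S(2)[of v] False by linarith
    ultimately have "S v = opp v" using S(1) by (intro card_subset_eq)
    then have "convert X f w = 1" if "w \<in> ?N v" for w
      using that opinion_cases[OF op, of w] \<open>v \<in> V\<close>
      by (auto simp: convert_def X_def opp_def neighborhood_def)
    then have "sum (convert X f) (?N v) = int (card (?N v))" by simp
    \<comment> \<open>The loop at \<open>v\<close> survives because \<open>D\<close> contains no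
      loops; the neighborhood is therefore nonempty and its unanimous vote positive.\<close>
    moreover have "v \<in> ?N v"
      using \<open>v \<in> V\<close> G D by (auto simp: neighborhood_def looped_graph_def)
    ultimately show ?thesis using finN by (auto simp: card_gt_0_iff)
  qed
  then have "positive_vertices V E f \<subseteq> positive_vertices V (E - D) (convert X f)"
    by (auto simp: positive_vertices_def)
  then have "strict_domination_number V (E - D) \<le> sum (convert X f) V"
    by (intro strict_domination_number_le strictly_majoritarian_mono[OF fin maj]
        opinion_function_convert fin op)
  also have "\<dots> = sum f V + 2 * int (card (V \<inter> X))" by (rule sum_convert[OF fin neg])
  also have "card (V \<inter> X) \<le> card X"
    using fin finS by (intro card_mono) (simp_all add: X_def)
  \<comment> \<open>The sets \<open>S v\<close> may overlap; a vertex chosen several times is paid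
    for only once.\<close>
  also have "card X \<le> (\<Sum>v\<in>V. card (S v))" unfolding X_def by (rule card_UN_le[OF fin])
  also have "\<dots> \<le> (\<Sum>v\<in>V. ?d v)" by (intro sum_mono) (simp add: S(2))
  finally show ?thesis by simp
qed

theorem theorem2:
  fixes V :: "'a set" and E D :: "'a set set" and f :: "'a \<Rightarrow> int"
    and k l s m :: nat
  assumes "looped_graph V E" and "V \<noteq> {}"
    and "optimal V E f"
    and "D \<subseteq> E" and "\<forall>v. {v} \<notin> D"
    and "card D = k" and "k = l + s + m"
    and "l = card {e \<in> D. \<exists>u v. e = {u, v} \<and> f u = 1 \<and> f v = 1}"
    and "s = card {e \<in> D. \<exists>u v. e = {u, v} \<and> f u = -1 \<and> f v = -1}"
    and "m = card {e \<in> D. \<exists>u v. e = {u, v} \<and> f u = 1 \<and> f v = -1}"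
  shows "- 4 * int l - 2 * int m
           \<le> strict_domination_number V E - strict_domination_number V (E - D)
       \<and> strict_domination_number V E - strict_domination_number V (E - D) \<le> 2 * int k"
proof
  have maj: "strictly_majoritarian V E f" and opt: "sum f V = strict_domination_number V E"
    using assms(3) by (auto simp: optimal_def)
  then have "opinion_function V f" by (simp add: strictly_majoritarian_def)
  from sum_card_lost_supporters_le[OF assms(1) this assms(4)]
  have "(\<Sum>v\<in>V. card (lost_supporters V D f v)) \<le> 2 * l + m"
    by (simp only: assms(8,10))
  \<comment> \<open>Optimality of \<open>f\<close> turns \<open>sum f V\<close> into the strict
    domination number of \<open>E\<close>, and each conversion costs 2, so \<open>2 * l + m\<close>
    becomes \<open>4 * l + 2 * m\<close>.\<close>
  moreover note strict_domination_number_delete_le[OF assms(1) maj assms(4,5)]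
  ultimately show "- 4 * int l - 2 * int m
      \<le> strict_domination_number V E - strict_domination_number V (E - D)"
    using opt by linarith
  show "strict_domination_number V E - strict_domination_number V (E - D) \<le> 2 * int k"
    using strict_domination_number_le_delete[OF assms(1,2,4,5)] assms(6) by simp
qed

end
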